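(* $$\frac{\pi}{2} = \sum_{k=0}^{\infty} \sum_{j=0}^{k+1} \binom{2k+3}{j} \frac{(-1)^{j+k+1}\, \operatorname{Si}(\pi(k+2-j))\,(k!)^2\, (k+2-j)}{(2k+1)!\, (k+1)(2k+4-j)}.$$
   Context: $\operatorname{Si}$ denotes the sine integral, $\operatorname{Si}(z) = \int_0^z \frac{\sin t}{t}\,dt$. The double series is an iterated sum: for each $k$ the inner sum over $j$ is finite, and the outer sum is an infinite series over $k$. *)

theory Defs
  imports "HOL-Probability.Sinc_Integral"
begin

end

theory Submission
  imports Defs
begin

text \<open>
  Put \<open>n = k + 2\<close>. The factor \<open>1 / (2k + 4 - j)\<close> turns \<open>2k + 3 choose j\<close> into
  \<open>(2n choose j) / 2n\<close>, so the \<open>k\<close>-th term is a constant times an alternating sum of the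
  \<open>(2n choose j) m Si(m \<pi>)\<close> over \<open>m = n - j\<close>. Substituting \<open>t = 2mu\<close> in the sine integral
  writes \<open>m Si(m \<pi>)\<close> as the integral of \<open>m sin(2mu) / u\<close> over \<open>[0, \<pi>/2]\<close>. The interval no
  longer depends on \<open>m\<close>, so the sum over \<open>j\<close> can be taken under the integral sign, where,
  up to a constant and the factor \<open>1 / u\<close>, it is the derivative of the binomial expansion of
  \<open>(2 sin u)^(2n)\<close> and collapses to one product \<open>n (2 sin u)^(2n-1) cos u\<close>
  (\<open>binomial_sum_sin\<close>).

  The constants that are left, \<open>(k!)^2 4^(k+1) / ((2k+1)! (k+1))\<close>, are the coefficients of
  \<open>s^(2k+2)\<close> in the power series of \<open>4 arcsin^2 s\<close>. Summing over \<open>k\<close> with \<open>s = sin u\<close>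
  therefore replaces them by \<open>4 u^2\<close> (\<open>arcsin_sq_sums\<close>). All summands are nonnegative, so the
  limit function dominates the partial sums and may be integrated instead of them; the result is
  the integral of \<open>4 u sin u cos u = 2 u sin(2u)\<close> over \<open>[0, \<pi>/2]\<close>, which is \<open>\<pi>/2\<close>.
\<close>

section \<open>The power series of the squared arcsine\<close>

text \<open>
  The coefficient of \<open>s^(2k+1)\<close> in \<open>arcsin s / sqrt (1 - s^2)\<close>. This function is the derivative
  of \<open>arcsin^2 s / 2\<close>, whose coefficients are thus \<open>arcsin_coeff k / (2k + 2)\<close>.
\<close>
definition arcsin_coeff :: "nat \<Rightarrow> real" where
  "arcsin_coeff k = 4 ^ k * (fact k)\<^sup>2 / fact (2 * k + 1)"

lemma arcsin_coeff_0 [simp]: "arcsin_coeff 0 = 1"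
  by (simp add: arcsin_coeff_def)

lemma arcsin_coeff_Suc:
  "(2 * real k + 3) * arcsin_coeff (Suc k) = (2 * real k + 2) * arcsin_coeff k"
proof -
  have "(fact (2 * Suc k + 1) :: real) = (2 * real k + 3) * (2 * real k + 2) * fact (2 * k + 1)"
    by (simp add: algebra_simps)
  moreover have "2 * real k + 3 \<noteq> 0" "2 * real k + 2 \<noteq> 0" by linarith+
  moreover have "(fact (2 * k + 1) :: real) \<noteq> 0" by (rule fact_nonzero)
  ultimately show ?thesis
    unfolding arcsin_coeff_def
    by (simp add: divide_simps del: fact_Suc) (simp add: algebra_simps power2_eq_square)
qed

lemma arcsin_coeff_pos: "arcsin_coeff k > 0"
  by (simp add: arcsin_coeff_def del: fact_Suc)

lemma arcsin_coeff_le_1: "arcsin_coeff k \<le> 1"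
proof (induction k)
  case (Suc k)
  have "(2 * real k + 3) * arcsin_coeff (Suc k) \<le> (2 * real k + 3) * arcsin_coeff k"
    unfolding arcsin_coeff_Suc using arcsin_coeff_pos[of k] by (intro mult_right_mono) auto
  then have "arcsin_coeff (Suc k) \<le> arcsin_coeff k"
    by (rule mult_left_le_imp_le) linarith
  with Suc show ?case by simp
qed simp

text \<open>
  Taylor's theorem of order two at \<open>0\<close> with a two-sided bound. The comparison functions are the
  constant \<open>0\<close> and the parabola with second derivative \<open>M\<close>.
\<close>
lemma second_derivative_sandwich:
  fixes F G H :: "real \<Rightarrow> real"
  assumes F: "\<And>x. (F has_real_derivative G x) (at x)"
    and G: "\<And>x. (G has_real_derivative H x) (at x)"
    and zero: "F 0 = 0" "G 0 = 0"
    and H: "\<And>x. 0 \<le> x \<Longrightarrow> x \<le> u \<Longrightarrow> 0 \<le> H x \<and> H x \<le> M"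
    and u: "0 \<le> u"
  shows "0 \<le> F u" and "F u \<le> M * u\<^sup>2 / 2"
proof -
  have G_bounds: "0 \<le> G x \<and> G x \<le> M * x" if "0 \<le> x" "x \<le> u" for x
  proof
    have "G 0 \<le> G x"
      by (rule DERIV_nonneg_imp_nondecreasing[OF that(1)]) (use G H that in force)
    then show "0 \<le> G x" using zero by simp
    have "M * 0 - G 0 \<le> M * x - G x"
    proof (rule DERIV_nonneg_imp_nondecreasing[OF that(1)])
      fix y assume y: "0 \<le> y" "y \<le> x"
      have "((\<lambda>y. M * y - G y) has_real_derivative M - H y) (at y)"
        by (auto intro!: derivative_eq_intros G)
      then show "\<exists>d. ((\<lambda>y. M * y - G y) has_real_derivative d) (at y) \<and> 0 \<le> d"
        using H[of y] y that by force
    qed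
    then show "G x \<le> M * x" using zero by simp
  qed
  have "F 0 \<le> F u"
    by (rule DERIV_nonneg_imp_nondecreasing[OF u]) (use F G_bounds in force)
  then show "0 \<le> F u" using zero by simp
  have "M * 0\<^sup>2 / 2 - F 0 \<le> M * u\<^sup>2 / 2 - F u"
  proof (rule DERIV_nonneg_imp_nondecreasing[OF u])
    fix y assume y: "0 \<le> y" "y \<le> u"
    have "((\<lambda>y. M * y\<^sup>2 / 2 - F y) has_real_derivative M * y - G y) (at y)"
      by (auto intro!: derivative_eq_intros F)
    then show "\<exists>d. ((\<lambda>y. M * y\<^sup>2 / 2 - F y) has_real_derivative d) (at y) \<and> 0 \<le> d"
      using G_bounds[of y] y by force
  qed
  then show "F u \<le> M * u\<^sup>2 / 2" using zero by simp
qed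

text \<open>
  In the variable \<open>u = arcsin s\<close> the second derivative of the remainder telescopes: the recurrence
  of the coefficients makes that of the \<open>k\<close>-th summand equal to \<open>t k - t (k + 1)\<close> for
  \<open>t k = (2k + 1) arcsin_coeff k sin^(2k) u\<close>, and \<open>t 0 = 1\<close> is the second derivative of
  \<open>u^2 / 2\<close>. Only \<open>t N\<close> remains, which is nonnegative and tends to \<open>0\<close> for \<open>u < \<pi>/2\<close>. The lower bound says that the
  partial sums stay below their limit also at \<open>u = \<pi>/2\<close>; the upper bound gives convergence
  below that endpoint.
\<close>
lemma arcsin_sq_partial_sum_bounds:
  fixes N :: nat
  assumes "0 \<le> u" "u \<le> pi / 2"
  defines "R \<equiv> u\<^sup>2 / 2 - (\<Sum>k<N. arcsin_coeff k * sin u ^ (2 * k + 2) / (2 * real k + 2))"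
  shows "0 \<le> R" and "R \<le> (2 * real N + 1) * (sin u)\<^sup>2 ^ N * u\<^sup>2 / 2"
proof -
  define F where "F = (\<lambda>x. x\<^sup>2 / 2 -
    (\<Sum>k<N. arcsin_coeff k * sin x ^ (2 * k + 2) / (2 * real k + 2)))"
  define G where "G = (\<lambda>x. x - (\<Sum>k<N. arcsin_coeff k * sin x ^ (2 * k + 1) * cos x))"
  define H where "H = (\<lambda>x. (2 * real N + 1) * arcsin_coeff N * sin x ^ (2 * N))"
  have F: "(F has_real_derivative G x) (at x)" for x
  proof -
    have "((\<lambda>x. arcsin_coeff k * sin x ^ (2 * k + 2) / (2 * real k + 2)) has_real_derivative
            arcsin_coeff k * sin x ^ (2 * k + 1) * cos x) (at x)" for k
    proof -
      have "((\<lambda>x. arcsin_coeff k * sin x ^ (2 * k + 2) / real (2 * k + 2)) has_real_derivative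
            arcsin_coeff k * (real (2 * k + 2) * (cos x * sin x ^ (2 * k + 1))) / real (2 * k + 2)) (at x)"
        by (intro DERIV_cdivide DERIV_cmult DERIV_cong[OF DERIV_fun_pow[OF DERIV_sin]])
           (simp add: mult_ac)
      then show ?thesis
        by (simp add: mult_ac del: of_nat_Suc) (simp add: add.commute)
    qed
    then show ?thesis
      unfolding F_def G_def
      by (intro DERIV_diff DERIV_sum) (auto intro!: derivative_eq_intros)
  qed
  have G: "(G has_real_derivative H x) (at x)" for x
  proof -
    define t where "t = (\<lambda>k. (2 * real k + 1) * arcsin_coeff k * sin x ^ (2 * k))"
    have step: "((\<lambda>x. arcsin_coeff k * sin x ^ (2 * k + 1) * cos x) has_real_derivative
            t k - t (Suc k)) (at x)" for k
    proof -
      have "t (Suc k) = ((2 * real k + 3) * arcsin_coeff (Suc k)) * sin x ^ (2 * k + 2)"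
        by (simp add: t_def)
      also have "\<dots> = (2 * real k + 2) * arcsin_coeff k * sin x ^ (2 * k) * (sin x)\<^sup>2"
        unfolding arcsin_coeff_Suc by (simp add: power2_eq_square)
      finally have eq: "t k - t (Suc k) = arcsin_coeff k * ((2 * real k + 1) * sin x ^ (2 * k) * (cos x)\<^sup>2
            - sin x ^ (2 * k) * (sin x)\<^sup>2)"
        by (simp add: t_def cos_squared_eq algebra_simps)
      show ?thesis
        unfolding eq
        by (rule derivative_eq_intros refl)+ (simp add: power2_eq_square algebra_simps)
    qed
    have "(G has_real_derivative 1 - (\<Sum>k<N. t k - t (Suc k))) (at x)"
      unfolding G_def by (rule derivative_eq_intros step refl)+
    moreover have "1 - (\<Sum>k<N. t k - t (Suc k)) = H x"
      by (simp add: sum_lessThan_telescope') (simp add: t_def H_def)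
    ultimately show ?thesis by simp
  qed
  have H: "0 \<le> H x \<and> H x \<le> (2 * real N + 1) * (sin u)\<^sup>2 ^ N" if x: "0 \<le> x" "x \<le> u" for x
  proof
    have sin: "0 \<le> sin x" "sin x \<le> sin u"
      using x assms by (auto intro!: sin_ge_zero sin_monotone_2pi_le)
    then show "0 \<le> H x" using arcsin_coeff_pos[of N] by (simp add: H_def)
    have "H x \<le> (2 * real N + 1) * 1 * sin u ^ (2 * N)"
      unfolding H_def using sin arcsin_coeff_pos[of N] arcsin_coeff_le_1[of N]
      by (intro mult_mono power_mono) auto
    then show "H x \<le> (2 * real N + 1) * (sin u)\<^sup>2 ^ N"
      by (simp add: power_mult)
  qed
  have "F 0 = 0" "G 0 = 0" by (simp_all add: F_def G_def)
  from second_derivative_sandwich[OF F G this H \<open>0 \<le> u\<close>]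
  show "0 \<le> R" and "R \<le> (2 * real N + 1) * (sin u)\<^sup>2 ^ N * u\<^sup>2 / 2"
    by (simp_all add: F_def R_def)
qed

lemma arcsin_sq_sums:
  assumes "0 \<le> u" "u < pi / 2"
  shows "(\<lambda>k. arcsin_coeff k * sin u ^ (2 * k + 2) / (2 * real k + 2)) sums (u\<^sup>2 / 2)"
proof -
  define q where "q = (sin u)\<^sup>2"
  have "sin u < 1" "0 \<le> sin u"
    using sin_monotone_2pi[of u "pi/2"] assms by (auto intro!: sin_ge_zero)
  then have q: "norm q < 1"
    by (simp add: q_def abs_square_less_1)
  have "(\<lambda>N. (2 * (real N * q ^ N) + q ^ N) * (u\<^sup>2 / 2)) \<longlonglongrightarrow> (2 * 0 + 0) * (u\<^sup>2 / 2)"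
    by (intro tendsto_intros powser_times_n_limit_0 LIMSEQ_power_zero q)
  moreover have "(\<lambda>N. (2 * (real N * q ^ N) + q ^ N) * (u\<^sup>2 / 2)) = (\<lambda>N. (2 * real N + 1) * q ^ N * u\<^sup>2 / 2)"
    by (simp add: fun_eq_iff algebra_simps)
  ultimately have lim: "(\<lambda>N. (2 * real N + 1) * q ^ N * u\<^sup>2 / 2) \<longlonglongrightarrow> 0"
    by (simp only: mult_zero_left mult_zero_right add_0_left)
  have "(\<lambda>N. u\<^sup>2 / 2 - (\<Sum>k<N. arcsin_coeff k * sin u ^ (2 * k + 2) / (2 * real k + 2))) \<longlonglongrightarrow> 0"
    by (rule tendsto_sandwich[OF _ _ tendsto_const lim])
       (use arcsin_sq_partial_sum_bounds[of u] assms in \<open>auto simp: q_def\<close>)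
  from tendsto_diff[OF tendsto_const[of "u\<^sup>2 / 2"] this] show ?thesis
    by (simp add: sums_def)
qed

section \<open>A binomial sum of sines\<close>

text \<open>
  Expand \<open>(cis u - cis (-u))^(2n) = (2 \<i> sin u)^(2n)\<close> and take real parts.
\<close>
lemma binomial_sum_cos:
  "(\<Sum>j\<le>2*n. (-1) ^ j * real (2*n choose j) * cos (2 * (real n - real j) * u))
     = (-1) ^ n * (2 * sin u) ^ (2*n)"
proof -
  have base: "cis u + - cis (-u) = 2 * \<i> * of_real (sin u)"
    by (simp add: complex_eq_iff)
  have "(cis u + - cis (-u)) ^ (2*n)
      = (\<Sum>j\<le>2*n. of_nat (2*n choose j) * (- cis (-u)) ^ j * cis u ^ (2*n - j))"
    by (subst add.commute) (rule binomial_ring)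
  also have "\<dots> = (\<Sum>j\<le>2*n. of_real ((-1) ^ j * real (2*n choose j)) * cis (2 * (real n - real j) * u))"
  proof (intro sum.cong refl)
    fix j assume "j \<in> {..2*n}"
    then have "(- cis (-u)) ^ j * cis u ^ (2*n - j) = (-1) ^ j * cis (2 * (real n - real j) * u)"
      by (subst power_minus) (simp add: Complex.DeMoivre cis_mult of_nat_diff algebra_simps)
    then show "of_nat (2*n choose j) * (- cis (-u)) ^ j * cis u ^ (2*n - j)
        = of_real ((-1) ^ j * real (2*n choose j)) * cis (2 * (real n - real j) * u)"
      by (simp add: mult.assoc)
  qed
  finally have "Re ((2 * \<i> * of_real (sin u)) ^ (2*n))
      = (\<Sum>j\<le>2*n. (-1) ^ j * real (2*n choose j) * cos (2 * (real n - real j) * u))"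
    unfolding base by (simp del: of_real_mult of_real_power)
  moreover have "(2 * \<i> * of_real (sin u)) ^ (2*n) = of_real ((-1) ^ n * (2 * sin u) ^ (2*n))"
    by (simp add: power_mult power_mult_distrib, subst power_minus, simp add: power_mult_distrib)
  ultimately show ?thesis by (simp only: Re_complex_of_real)
qed

text \<open>
  Differentiate the cosine sum with respect to \<open>u\<close>. The resulting summands agree at \<open>j\<close> and
  \<open>2n - j\<close> and vanish at \<open>j = n\<close>, so half of the full sum is the sum over \<open>j < n\<close>.
\<close>
lemma binomial_sum_sin:
  assumes "n > 0"
  shows "(\<Sum>j<n. (-1) ^ (n + j + 1) * real (2*n choose j) * (real n - real j)
                  * sin (2 * (real n - real j) * u))
           = real n * (2 * sin u) ^ (2*n - 1) * cos u"
proof -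
  define s where "s = (\<lambda>j. (-1) ^ (j + 1) * real (2*n choose j) * (real n - real j)
                  * sin (2 * (real n - real j) * u))"
  have d1: "((\<lambda>u. \<Sum>j\<le>2*n. (-1) ^ j * real (2*n choose j) * cos (2 * (real n - real j) * u))
      has_real_derivative (\<Sum>j\<le>2*n. 2 * s j)) (at u)"
    by (rule derivative_eq_intros refl)+ (auto simp: s_def algebra_simps intro!: sum.cong)
  have d2: "((\<lambda>u. (-1) ^ n * (2 * sin u) ^ (2*n)) has_real_derivative
      4 * (-1) ^ n * real n * (2 * sin u) ^ (2*n - 1) * cos u) (at u)"
    by (rule derivative_eq_intros refl | simp)+
  have total: "(\<Sum>j\<le>2*n. 2 * s j) = 4 * (-1) ^ n * real n * (2 * sin u) ^ (2*n - 1) * cos u"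
    using DERIV_unique[OF d1[unfolded binomial_sum_cos] d2] .
  have sym: "s (2*n - j) = s j" if "j < n" for j
  proof -
    have "(-1 :: real) ^ (2*n - j + 1) = (-1) ^ (j + 1)"
      using that by (simp add: minus_one_power_iff)
    moreover have "2*n choose (2*n - j) = 2*n choose j"
      using that by (intro binomial_symmetric[symmetric]) auto
    moreover have "real n - real (2*n - j) = - (real n - real j)"
      using that by (simp add: of_nat_diff)
    ultimately show ?thesis
      unfolding s_def by (simp only: mult_minus_right mult_minus_left sin_minus minus_minus)
  qed
  have "(\<Sum>j\<le>2*n. s j) = (\<Sum>j<n. s j) + s n + (\<Sum>j\<in>{n<..2*n}. s j)"
  proof -
    have "{..2*n} = insert n {..<n} \<union> {n<..2*n}" by auto
    then have "(\<Sum>j\<le>2*n. s j) = (\<Sum>j\<in>insert n {..<n}. s j) + (\<Sum>j\<in>{n<..2*n}. s j)"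
      by (simp only:) (rule sum.union_disjoint; auto)
    then show ?thesis by simp
  qed
  also have "s n = 0" by (simp add: s_def)
  also have "(\<Sum>j\<in>{n<..2*n}. s j) = (\<Sum>j<n. s j)"
    by (rule sum.reindex_bij_witness[symmetric, of _ "\<lambda>j. 2*n - j" "\<lambda>j. 2*n - j"])
       (auto simp: sym)
  finally have "(\<Sum>j<n. s j) = (-1) ^ n * (real n * (2 * sin u) ^ (2*n - 1) * cos u)"
    using total by (simp add: sum_distrib_left[symmetric])
  then have "(-1) ^ n * (\<Sum>j<n. s j) = real n * (2 * sin u) ^ (2*n - 1) * cos u"
    by simp
  then show ?thesis
    by (simp add: s_def sum_distrib_left power_add mult.assoc)
qed

section \<open>The terms as integrals\<close>

text \<open>
  The integrand is the derivative of \<open>Si (2 m u)\<close>; off \<open>u = 0\<close> it is \<open>sin (2 m u) / u\<close>.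
  Using \<open>sinc\<close> keeps it continuous at \<open>0\<close>.
\<close>
lemma has_integral_Si:
  "((\<lambda>u. 2 * m * sinc (2 * m * u)) has_integral Si (m * pi)) {0..pi/2}"
proof -
  have "((\<lambda>u. 2 * m * sinc (2 * m * u)) has_integral (Si (2 * m * (pi / 2)) - Si (2 * m * 0))) {0..pi/2}"
  proof (rule fundamental_theorem_of_calculus)
    fix x :: real
    have "((\<lambda>u. Si (2 * m * u)) has_real_derivative sinc (2 * m * x) * (2 * m)) (at x)"
      by (rule DERIV_chain2[OF DERIV_Si]) (auto intro!: derivative_eq_intros)
    then show "((\<lambda>u. Si (2 * m * u)) has_vector_derivative 2 * m * sinc (2 * m * x)) (at x within {0..pi/2})"
      by (simp only: has_real_derivative_iff_has_vector_derivative mult.commute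
            has_vector_derivative_at_within)
  qed simp
  moreover have "Si 0 = 0" by (simp add: Si_alt_def zero_ereal_def[symmetric])
  ultimately show ?thesis by (simp add: mult.commute)
qed

text \<open>
  Both integrands are \<open>1 / u\<close> times the two sides of \<open>binomial_sum_sin\<close>, except at the single
  point \<open>u = 0\<close>, which integration ignores.
\<close>
lemma binomial_sum_Si:
  assumes "n > 0"
  shows "((\<lambda>u. real n * 2 ^ (2*n - 1) * sin u ^ (2*n - 2) * (cos u * sinc u)) has_integral
      (\<Sum>j<n. (-1) ^ (n + j + 1) * real (2*n choose j) * (real n - real j)
          * Si (pi * (real n - real j)))) {0..pi/2}"
proof -
  let ?c = "\<lambda>j. (-1) ^ (n + j + 1) * real (2*n choose j) * (real n - real j)"
  have "((\<lambda>u. \<Sum>j<n. ?c j * (2 * (real n - real j) * sinc (2 * (real n - real j) * u))) has_integral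
      (\<Sum>j<n. ?c j * Si ((real n - real j) * pi))) {0..pi/2}"
    by (intro has_integral_sum has_integral_mult_right has_integral_Si) auto
  then have "((\<lambda>u. \<Sum>j<n. ?c j * (2 * (real n - real j) * sinc (2 * (real n - real j) * u))) has_integral
      (\<Sum>j<n. ?c j * Si (pi * (real n - real j)))) {0..pi/2}"
    by (simp only: mult.commute[of pi])
  then show ?thesis
  proof (rule has_integral_spike_finite[rotated 2])
    fix u :: real assume u: "u \<in> {0..pi/2} - {0}"
    have "(\<Sum>j<n. ?c j * (2 * (real n - real j) * sinc (2 * (real n - real j) * u)))
        = (\<Sum>j<n. ?c j * sin (2 * (real n - real j) * u)) / u"
      unfolding sum_divide_distrib using u by (intro sum.cong) auto
    also have "\<dots> = real n * (2 * sin u) ^ (2*n - 1) * cos u / u"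
      by (simp only: binomial_sum_sin[OF assms])
    also have "(2 * sin u) ^ (2*n - 1) = 2 ^ (2*n - 1) * sin u ^ (2*n - 2) * sin u"
      using assms by (cases n) (simp_all add: power_mult_distrib)
    finally show "real n * 2 ^ (2*n - 1) * sin u ^ (2*n - 2) * (cos u * sinc u)
        = (\<Sum>j<n. ?c j * (2 * (real n - real j) * sinc (2 * (real n - real j) * u)))"
      using u by simp
  qed auto
qed

text \<open>
  The preceding integral for \<open>n = k + 2\<close>, rescaled. The factor \<open>8 / (2k + 2)\<close> is 8 times the one
  that belongs to the series of \<open>arcsin^2 s / 2\<close>, so that the terms add up to \<open>4 arcsin^2 s\<close>.
\<close>
lemma term_has_integral:
  "((\<lambda>u. 8 * (arcsin_coeff k * sin u ^ (2 * k + 2) / (2 * real k + 2)) * (cos u * sinc u)) has_integral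
     (\<Sum>j=0..k+1.
            real ((2 * k + 3) choose j) *
            (((-1) ^ (j + k + 1) * Si (pi * (real k + 2 - real j)) * (fact k)\<^sup>2 * (real k + 2 - real j))
             / (fact (2 * k + 1) * (real k + 1) * (2 * real k + 4 - real j))))) {0..pi/2}"
proof -
  define n where "n = k + 2"
  define K :: real where "K = (fact k)\<^sup>2 / (fact (2 * k + 1) * (real k + 1) * (2 * real n))"
  have "((\<lambda>u. K * (real n * 2 ^ (2*n - 1) * sin u ^ (2*n - 2) * (cos u * sinc u))) has_integral
      K * (\<Sum>j<n. (-1) ^ (n + j + 1) * real (2*n choose j) * (real n - real j)
          * Si (pi * (real n - real j)))) {0..pi/2}"
    by (intro has_integral_mult_right binomial_sum_Si) (simp add: n_def)
  moreover have "K * (real n * 2 ^ (2*n - 1) * sin u ^ (2*n - 2) * (cos u * sinc u))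
     = 8 * (arcsin_coeff k * sin u ^ (2 * k + 2) / (2 * real k + 2)) * (cos u * sinc u)" for u
  proof -
    have "(2::real) ^ (2*n - 1) = 8 * 4 ^ k"
      using power_mult[of "2::real" 2 k] by (simp add: n_def power_add eval_nat_numeral)
    moreover have "K * real n = (fact k)\<^sup>2 / (fact (2 * k + 1) * (2 * real k + 2))"
      by (simp add: K_def n_def divide_simps del: fact_Suc) (simp add: algebra_simps)
    ultimately have "K * (real n * 2 ^ (2*n - 1)) = 8 * arcsin_coeff k / (2 * real k + 2)"
      by (simp add: arcsin_coeff_def mult.assoc[symmetric] del: fact_Suc)
    moreover have "2 * n - 2 = 2 * k + 2" by (simp add: n_def)
    ultimately show ?thesis by (simp add: mult.assoc[symmetric])
  qed
  moreover have "K * (\<Sum>j<n. (-1) ^ (n + j + 1) * real (2*n choose j) * (real n - real j)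
          * Si (pi * (real n - real j)))
    = (\<Sum>j=0..k+1.
            real ((2 * k + 3) choose j) *
            (((-1) ^ (j + k + 1) * Si (pi * (real k + 2 - real j)) * (fact k)\<^sup>2 * (real k + 2 - real j))
             / (fact (2 * k + 1) * (real k + 1) * (2 * real k + 4 - real j))))"
    unfolding sum_distrib_left
  proof (rule sum.cong)
    show "{..<n} = {0..k+1}" by (auto simp: n_def)
    fix j assume "j \<in> {0..k+1}"
    then have j: "j \<le> k + 1" by simp
    \<comment> \<open>Absorption: this is where the factor \<open>2k + 4 - j\<close> in the denominator disappears.\<close>
    have "(2*n - j) * (2*n choose j) = 2*n * (2*k + 3 choose j)"
      using binomial_absorb_comp[of "2*n" j] by (simp add: n_def numeral_eq_Suc)
    then have "real (2*n - j) * real (2*n choose j) = 2 * real n * real (2*k + 3 choose j)"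
      by (metis of_nat_mult of_nat_numeral)
    moreover have "real (2*n - j) = 2 * real k + 4 - real j" using j by (simp add: n_def of_nat_diff)
    ultimately have choose: "real (2*n choose j) / (2 * real n) = real (2*k + 3 choose j) / (2 * real k + 4 - real j)"
      using j by (simp add: n_def field_simps)
    have sgn: "(-1 :: real) ^ (n + j + 1) = (-1) ^ (j + k + 1)"
      by (simp add: n_def power_add)
    have rn: "real n - real j = real k + 2 - real j" by (simp add: n_def)
    have "K * ((-1) ^ (n + j + 1) * real (2*n choose j) * (real n - real j) * Si (pi * (real n - real j)))
      = (real (2*n choose j) / (2 * real n)) * (((-1) ^ (j + k + 1) * Si (pi * (real k + 2 - real j))
          * (fact k)\<^sup>2 * (real k + 2 - real j)) / (fact (2 * k + 1) * (real k + 1)))"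
      unfolding K_def sgn rn by (simp add: field_simps del: fact_Suc)
    then show "K * ((-1) ^ (n + j + 1) * real (2*n choose j) * (real n - real j) * Si (pi * (real n - real j)))
      = real ((2 * k + 3) choose j) *
            (((-1) ^ (j + k + 1) * Si (pi * (real k + 2 - real j)) * (fact k)\<^sup>2 * (real k + 2 - real j))
             / (fact (2 * k + 1) * (real k + 1) * (2 * real k + 4 - real j)))"
      unfolding choose by (simp add: mult_ac del: fact_Suc)
  qed
  ultimately show ?thesis by simp
qed

lemma has_integral_sq_cos_sinc:
  "((\<lambda>u. 4 * u\<^sup>2 * (cos u * sinc u)) has_integral pi / 2) {0..pi/2}"
proof -
  have "((\<lambda>u. 4 * u\<^sup>2 * (cos u * sinc u)) has_integral
     ((sin (2 * (pi/2)) / 2 - (pi/2) * cos (2 * (pi/2))) - (sin (2 * 0) / 2 - 0 * cos (2 * 0)))) {0..pi/2}"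
  proof (rule fundamental_theorem_of_calculus)
    fix x :: real
    have "((\<lambda>u. sin (2 * u) / 2 - u * cos (2 * u)) has_real_derivative 4 * x\<^sup>2 * (cos x * sinc x)) (at x)"
      by (rule derivative_eq_intros refl | simp add: sin_double power2_eq_square)+
    then show "((\<lambda>u. sin (2 * u) / 2 - u * cos (2 * u)) has_vector_derivative 4 * x\<^sup>2 * (cos x * sinc x))
        (at x within {0..pi/2})"
      by (simp only: has_real_derivative_iff_has_vector_derivative has_vector_derivative_at_within)
  qed simp
  then show ?thesis by simp
qed

theorem theorem2:
  shows "(\<lambda>k::nat. \<Sum>j=0..k+1.
            real ((2 * k + 3) choose j) *
            (((-1) ^ (j + k + 1) * Si (pi * (real k + 2 - real j)) * (fact k)\<^sup>2 * (real k + 2 - real j))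
             / (fact (2 * k + 1) * (real k + 1) * (2 * real k + 4 - real j))))
         sums (pi / 2)" (is "?a sums _")
proof -
  define p where "p = (\<lambda>N u. \<Sum>k<N. arcsin_coeff k * sin u ^ (2 * k + 2) / (2 * real k + 2))"
  define f where "f = (\<lambda>N u. 8 * p N u * (cos u * sinc u))"
  let ?h = "\<lambda>u. 4 * u\<^sup>2 * (cos u * sinc u)"
  have f_int: "(f N has_integral (\<Sum>k<N. ?a k)) {0..pi/2}" for N
    unfolding f_def p_def sum_distrib_left sum_distrib_right
    by (intro has_integral_sum term_has_integral) auto
  have bound: "norm (f N u) \<le> ?h u" if u: "u \<in> {0..pi/2}" for N u
  proof -
    have "0 \<le> sin u" "0 \<le> cos u" using u by (auto intro!: sin_ge_zero cos_ge_zero)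
    then have w: "0 \<le> cos u * sinc u" using u by auto
    have "0 \<le> p N u" unfolding p_def
      using \<open>0 \<le> sin u\<close> arcsin_coeff_pos by (intro sum_nonneg divide_nonneg_nonneg mult_nonneg_nonneg
        less_imp_le[OF arcsin_coeff_pos] zero_le_power) auto
    moreover have "p N u \<le> u\<^sup>2 / 2"
      using arcsin_sq_partial_sum_bounds(1)[of u N] u by (simp add: p_def)
    ultimately have "\<bar>8 * p N u\<bar> \<le> 4 * u\<^sup>2" by simp
    then show ?thesis
      unfolding f_def real_norm_def abs_mult[of "8 * p N u"] abs_of_nonneg[OF w]
      using w by (rule mult_right_mono)
  qed
  have lim: "(\<lambda>N. f N u) \<longlonglongrightarrow> ?h u" if u: "u \<in> {0..pi/2}" for u
  proof (cases "u = pi / 2")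
    case True
    \<comment> \<open>The bound on the remainder is useless at this endpoint, but the factor \<open>cos u\<close> vanishes.\<close>
    show ?thesis unfolding f_def True by simp
  next
    case False
    then have "(\<lambda>N. p N u) \<longlonglongrightarrow> u\<^sup>2 / 2"
      using arcsin_sq_sums[of u] u by (simp add: p_def sums_def)
    then have "(\<lambda>N. f N u) \<longlonglongrightarrow> 8 * (u\<^sup>2 / 2) * (cos u * sinc u)"
      unfolding f_def by (intro tendsto_intros)
    then show ?thesis by simp
  qed
  have "(\<lambda>N. integral {0..pi/2} (f N)) \<longlonglongrightarrow> integral {0..pi/2} ?h"
    by (rule dominated_convergence(2)[where h = ?h])
       (use f_int has_integral_sq_cos_sinc bound lim in \<open>auto intro: has_integral_integrable\<close>)
  then show ?thesis
    by (simp only: integral_unique[OF f_int] integral_unique[OF has_integral_sq_cos_sinc] sums_def)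
qed

end
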